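(* Let $L(t,q,\dot q)$ be a Lagrangian function ($t\in\mathbb{R}$, $q,\dot q\in\mathbb{R}^n$) of class $C^3$ with $\det \partial^2_{\dot q,\dot q}L(t,q,\dot q)\neq 0$ everywhere. Suppose that the Lagrange equation of $L$ has the $C^1$ first integral $N(t,q,\dot q)$. Let $(\tau,\xi,f)$ be a triple of $C^1$ functions of $(t,q,\dot q)$, with $\tau,f$ real-valued and $\xi$ valued in $\mathbb{R}^n$. Then $(\tau,\xi,f)$ is a solution of the on-flow version of the Killing-type equation with $N$ as associated first integral if and only if $$f=\tau L+N+\partial_{\dot q}L\cdot(\xi-\tau\dot q)$$ identically in $(t,q,\dot q)$.
   Context: All functions are functions of the independent variables $t\in\mathbb{R}$, $q,\dot q\in\mathbb{R}^n$. $\partial_t,\partial_q,\partial_{\dot q}$ denote partial derivative and gradients, $\cdot$ is the standard scalar product of $\mathbb{R}^n$, and $\partial^2_{\dot q,\dot q}L$ is the Hessian matrix of $L$ with respect to $\dot q$. The Lagrange equation is $\frac{d}{dt}\partial_{\dot q}L(t,q(t),\dot q(t))-\partial_qL(t,q(t),\dot q(t))=0$; since $\det\partial^2_{\dot q,\dot q}L\ne0$ it can be put in normal form $\ddot q=\Lambda(t,q,\dot q)$, with $\Lambda=(\partial^2_{\dot q,\dot q}L)^{-1}(\partial_qL-\partial^2_{\dot q,t}L-\partial^2_{\dot q,q}L\,\dot q)$. A $C^1$ function $N(t,q,\dot q)$ is a first integral if it is constant along all solutions of the Lagrange equation, i.e. $\partial_tN+\partial_qN\cdot\dot q+\partial_{\dot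 q}N\cdot\Lambda=0$ identically. The Killing-type equation for a triple $(\tau,\xi,f)$ is $$\tau\,\partial_tL+\partial_qL\cdot\xi+\partial_{\dot q}L\cdot(\dot\xi-\dot q\,\dot\tau)+L\,\dot\tau=\dot f .$$ On-flow version: the total time derivative of $x\in\{\tau,\xi,f\}$ is interpreted as $\dot x=\partial_tx+(\partial_qx)\dot q+(\partial_{\dot q}x)\Lambda(t,q,\dot q)$ (that is, $\ddot q$ is replaced by $\Lambda(t,q,\dot q)$), and the equation is required to hold for all $t,q,\dot q$. The first integral associated to a solution triple $(\tau,\xi,f)$ is the function $f-L\tau-\partial_{\dot q}L\cdot(\xi-\dot q\,\tau)$; "with $N$ as associated first integral" means that this function equals $N$. *)

theory Defs
  imports "HOL-Analysis.Analysis"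
begin

(* Functions of (t,q,v), with v standing for the velocity, are curried; smoothness always
   refers to all variables jointly. *)

text \<open>
  Class \<open>C\<^sup>k\<close> on the whole space. Recursion on \<open>k\<close> goes through directional
  derivatives so that the type of the function
  does not change; on a Euclidean space, continuity of all directional derivatives
  is continuity of the derivative.
\<close>

fun C_class :: "nat \<Rightarrow> ('a::euclidean_space \<Rightarrow> 'b::euclidean_space) \<Rightarrow> bool" where
  "C_class 0 f \<longleftrightarrow> continuous_on UNIV f"
| "C_class (Suc k) f \<longleftrightarrow>
     (\<forall>x. f differentiable at x) \<and> (\<forall>h. C_class k (\<lambda>x. frechet_derivative f (at x) h))"

definition C_class_tqv ::
    "nat \<Rightarrow> (real \<Rightarrow> real ^ 'n \<Rightarrow> real ^ 'n \<Rightarrow> 'b::euclidean_space) \<Rightarrow> bool" where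
  "C_class_tqv k F \<longleftrightarrow> C_class k (\<lambda>(t, q, v). F t q v)"

definition pd_t ::
    "(real \<Rightarrow> real ^ 'n \<Rightarrow> real ^ 'n \<Rightarrow> 'b::real_normed_vector)
      \<Rightarrow> real \<Rightarrow> real ^ 'n \<Rightarrow> real ^ 'n \<Rightarrow> 'b" where
  "pd_t F t q v = vector_derivative (\<lambda>s. F s q v) (at t)"

text \<open>\<open>pd_q F t q v h\<close> and \<open>pd_v F t q v h\<close> are the partial differentials applied to \<open>h\<close>.\<close>

definition pd_q ::
    "(real \<Rightarrow> real ^ 'n \<Rightarrow> real ^ 'n \<Rightarrow> 'b::real_normed_vector)
      \<Rightarrow> real \<Rightarrow> real ^ 'n \<Rightarrow> real ^ 'n \<Rightarrow> real ^ 'n \<Rightarrow> 'b" where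
  "pd_q F t q v = frechet_derivative (\<lambda>y. F t y v) (at q)"

definition pd_v ::
    "(real \<Rightarrow> real ^ 'n \<Rightarrow> real ^ 'n \<Rightarrow> 'b::real_normed_vector)
      \<Rightarrow> real \<Rightarrow> real ^ 'n \<Rightarrow> real ^ 'n \<Rightarrow> real ^ 'n \<Rightarrow> 'b" where
  "pd_v F t q v = frechet_derivative (\<lambda>w. F t q w) (at v)"

definition grad_q ::
    "(real \<Rightarrow> real ^ 'n \<Rightarrow> real ^ 'n \<Rightarrow> real) \<Rightarrow> real \<Rightarrow> real ^ 'n \<Rightarrow> real ^ 'n \<Rightarrow> real ^ 'n" where
  "grad_q F t q v = (\<chi> i. pd_q F t q v (axis i 1))"

definition grad_v ::
    "(real \<Rightarrow> real ^ 'n \<Rightarrow> real ^ 'n \<Rightarrow> real) \<Rightarrow> real \<Rightarrow> real ^ 'n \<Rightarrow> real ^ 'n \<Rightarrow> real ^ 'n" where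
  "grad_v F t q v = (\<chi> i. pd_v F t q v (axis i 1))"

text \<open>
  The second-derivative matrices have \<open>(i, j)\<close> entry
  \<open>\<partial>\<^sup>2L / \<partial>v\<^sub>i \<partial>v\<^sub>j\<close> and \<open>\<partial>\<^sup>2L / \<partial>v\<^sub>i \<partial>q\<^sub>j\<close> respectively.
\<close>

definition hess_vv ::
    "(real \<Rightarrow> real ^ 'n \<Rightarrow> real ^ 'n \<Rightarrow> real) \<Rightarrow> real \<Rightarrow> real ^ 'n \<Rightarrow> real ^ 'n \<Rightarrow> real ^ 'n ^ 'n" where
  "hess_vv L t q v = matrix (pd_v (grad_v L) t q v)"

definition hess_vq ::
    "(real \<Rightarrow> real ^ 'n \<Rightarrow> real ^ 'n \<Rightarrow> real) \<Rightarrow> real \<Rightarrow> real ^ 'n \<Rightarrow> real ^ 'n \<Rightarrow> real ^ 'n ^ 'n" where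
  "hess_vq L t q v = matrix (pd_q (grad_v L) t q v)"

definition velocity :: "(real \<Rightarrow> real ^ 'n) \<Rightarrow> real \<Rightarrow> real ^ 'n" where
  "velocity q t = vector_derivative q (at t)"

definition lagrange_solution ::
    "(real \<Rightarrow> real ^ 'n \<Rightarrow> real ^ 'n \<Rightarrow> real) \<Rightarrow> real set \<Rightarrow> (real \<Rightarrow> real ^ 'n) \<Rightarrow> bool" where
  "lagrange_solution L I q \<longleftrightarrow>
     open I \<and> is_interval I \<and>
     (\<forall>t\<in>I. q differentiable at t \<and> velocity q differentiable at t \<and>
        ((\<lambda>s. grad_v L s (q s) (velocity q s)) has_vector_derivative
           grad_q L t (q t) (velocity q t)) (at t))"

definition first_integral ::
    "(real \<Rightarrow> real ^ 'n \<Rightarrow> real ^ 'n \<Rightarrow> real) \<Rightarrow> (real \<Rightarrow> real ^ 'n \<Rightarrow> real ^ 'n \<Rightarrow> real) \<Rightarrow> bool" where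
  "first_integral L N \<longleftrightarrow>
     C_class_tqv 1 N \<and>
     (\<forall>I q. lagrange_solution L I q \<longrightarrow> (\<lambda>t. N t (q t) (velocity q t)) constant_on I)"

text \<open>Right-hand side of the normal form \<open>q'' = Lam L t q q'\<close> of the Lagrange equation.\<close>

definition Lam ::
    "(real \<Rightarrow> real ^ 'n \<Rightarrow> real ^ 'n \<Rightarrow> real) \<Rightarrow> real \<Rightarrow> real ^ 'n \<Rightarrow> real ^ 'n \<Rightarrow> real ^ 'n" where
  "Lam L t q v =
     matrix_inv (hess_vv L t q v) *v
       (grad_q L t q v - pd_t (grad_v L) t q v - hess_vq L t q v *v v)"

definition flow_deriv ::
    "(real \<Rightarrow> real ^ 'n \<Rightarrow> real ^ 'n \<Rightarrow> real)
      \<Rightarrow> (real \<Rightarrow> real ^ 'n \<Rightarrow> real ^ 'n \<Rightarrow> 'b::real_normed_vector)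
      \<Rightarrow> real \<Rightarrow> real ^ 'n \<Rightarrow> real ^ 'n \<Rightarrow> 'b" where
  "flow_deriv L x t q v = pd_t x t q v + pd_q x t q v v + pd_v x t q v (Lam L t q v)"

definition killing_on_flow ::
    "(real \<Rightarrow> real ^ 'n \<Rightarrow> real ^ 'n \<Rightarrow> real)
      \<Rightarrow> (real \<Rightarrow> real ^ 'n \<Rightarrow> real ^ 'n \<Rightarrow> real)
      \<Rightarrow> (real \<Rightarrow> real ^ 'n \<Rightarrow> real ^ 'n \<Rightarrow> real ^ 'n)
      \<Rightarrow> (real \<Rightarrow> real ^ 'n \<Rightarrow> real ^ 'n \<Rightarrow> real) \<Rightarrow> bool" where
  "killing_on_flow L \<tau> \<xi> f \<longleftrightarrow>
     (\<forall>t q v.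
        \<tau> t q v * pd_t L t q v
        + grad_q L t q v \<bullet> \<xi> t q v
        + grad_v L t q v \<bullet> (flow_deriv L \<xi> t q v - flow_deriv L \<tau> t q v *\<^sub>R v)
        + L t q v * flow_deriv L \<tau> t q v
        = flow_deriv L f t q v)"

definition associated_integral ::
    "(real \<Rightarrow> real ^ 'n \<Rightarrow> real ^ 'n \<Rightarrow> real)
      \<Rightarrow> (real \<Rightarrow> real ^ 'n \<Rightarrow> real ^ 'n \<Rightarrow> real)
      \<Rightarrow> (real \<Rightarrow> real ^ 'n \<Rightarrow> real ^ 'n \<Rightarrow> real ^ 'n)
      \<Rightarrow> (real \<Rightarrow> real ^ 'n \<Rightarrow> real ^ 'n \<Rightarrow> real)
      \<Rightarrow> real \<Rightarrow> real ^ 'n \<Rightarrow> real ^ 'n \<Rightarrow> real" where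
  "associated_integral L \<tau> \<xi> f t q v =
     f t q v - L t q v * \<tau> t q v - grad_v L t q v \<bullet> (\<xi> t q v - \<tau> t q v *\<^sub>R v)"

end

theory Submission
  imports Defs
begin

text \<open>
  The formula for \<open>f\<close> is the equation "the associated integral equals \<open>N\<close>", solved for \<open>f\<close>, so
  the forward implication is a rearrangement. The content of the converse is that every triple whose
  associated integral is \<open>N\<close> solves the on-flow Killing-type equation, whatever \<open>\<tau>\<close> and \<open>\<xi>\<close> are.

  Write \<open>D\<close> for the total derivative along the flow, that is \<open>flow_deriv L\<close>. It is the derivative in
  the direction \<open>(1, v, Lam L t q v)\<close>, hence a derivation. Two facts determine \<open>D\<close> of the formula:
  the normal form of the Lagrange equation says \<open>D (grad_v L) = grad_q L\<close> (lemma
  \<open>flow_deriv_grad_v\<close>), and the velocity has derivative \<open>Lam L\<close>. With the Leibniz rule the terms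
  \<open>\<plusminus> \<tau> (grad_q L \<bullet> v)\<close> and \<open>\<plusminus> \<tau> (grad_v L \<bullet> Lam L)\<close> cancel, and \<open>D f\<close> is the left-hand side of
  the Killing-type equation plus \<open>D N\<close> (lemma \<open>flow_deriv_noether\<close>).

  It remains to see that \<open>D N = 0\<close> at every point (lemma \<open>first_integral_flow_deriv\<close>). Being a first
  integral only restricts \<open>N\<close> along solutions, so a solution with arbitrary initial data
  \<open>(t, q, v)\<close> is required; \<open>N\<close> is constant along it and its derivative there is \<open>D N t q v\<close>. Such
  a solution exists by the Picard-Lindeloef theorem, because \<open>Lam L\<close> is \<open>C\<^sup>1\<close>: by Cramer's rule its
  components are rational expressions in \<open>v\<close> and in derivatives of \<open>L\<close> of order at most two,
  with denominator the nowhere vanishing Hessian determinant.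
\<close>

section \<open>Closure properties of the class of k times continuously differentiable maps\<close>

lemma C_class_SucI:
  assumes "\<And>x. (f has_derivative f' x) (at x)"
    and "\<And>h. C_class k (\<lambda>x. f' x h)"
  shows "C_class (Suc k) f"
proof -
  have "frechet_derivative f (at x) = f' x" for x
    using assms(1) frechet_derivative_at by metis
  then show ?thesis
    using assms by (auto simp: differentiable_def)
qed

lemma C_class_SucD:
  assumes "C_class (Suc k) f"
  shows "(f has_derivative frechet_derivative f (at x)) (at x)"
    and "C_class k (\<lambda>x. frechet_derivative f (at x) h)"
  using assms by (auto simp: frechet_derivative_works)

lemma C_class_Suc_imp: "C_class (Suc k) f \<Longrightarrow> C_class k f"
proof (induction k arbitrary: f)
  case 0
  then show ?case
    by (auto intro!: continuous_at_imp_continuous_on differentiable_imp_continuous_within)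
next
  case (Suc k)
  show ?case
    using C_class_SucD[OF Suc.prems] Suc.IH by (intro C_class_SucI) auto
qed

lemma C_class_mono: "C_class m f \<Longrightarrow> k \<le> m \<Longrightarrow> C_class k f"
  by (induction m) (auto simp: le_Suc_eq simp del: C_class.simps dest: C_class_Suc_imp)

lemma C_class_const: "C_class k (\<lambda>x. c)"
proof (induction k arbitrary: c)
  case (Suc k)
  show ?case
    by (rule C_class_SucI[where f' = "\<lambda>x h. 0"]) (auto intro: Suc)
qed auto

lemma C_class_linear:
  assumes "bounded_linear T" and "C_class k f"
  shows "C_class k (\<lambda>x. T (f x))"
  using assms(2)
proof (induction k arbitrary: f)
  case 0
  then show ?case
    by (simp add: bounded_linear.continuous_on[OF assms(1)])
next
  case (Suc k)
  note D = C_class_SucD[OF Suc.prems]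
  show ?case
    by (rule C_class_SucI[OF bounded_linear.has_derivative[OF assms(1) D(1)]])
      (rule Suc.IH[OF D(2)])
qed

lemma C_class_add:
  assumes "C_class k f" and "C_class k g"
  shows "C_class k (\<lambda>x. f x + g x)"
  using assms
proof (induction k arbitrary: f g)
  case 0
  then show ?case by (simp add: continuous_on_add)
next
  case (Suc k)
  note D = C_class_SucD[OF Suc.prems(1)] C_class_SucD[OF Suc.prems(2)]
  show ?case
    by (rule C_class_SucI[OF has_derivative_add[OF D(1) D(3)]]) (rule Suc.IH[OF D(2) D(4)])
qed

text \<open>
  For \<open>f\<close> and \<open>g\<close> of class \<open>C\<^sup>k\<^sup>+\<^sup>1\<close> the Leibniz rule expresses the derivative through \<open>f\<close>, \<open>g\<close> and
  their derivatives, all of which are of class \<open>C\<^sup>k\<close>, so the induction hypothesis applies.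
\<close>

lemma C_class_bilinear:
  assumes "bounded_bilinear B" and "C_class k f" and "C_class k g"
  shows "C_class k (\<lambda>x. B (f x) (g x))"
  using assms(2,3)
proof (induction k arbitrary: f g)
  case 0
  then show ?case by (simp add: bounded_bilinear.continuous_on[OF assms(1)])
next
  case (Suc k)
  note D = C_class_SucD[OF Suc.prems(1)] C_class_SucD[OF Suc.prems(2)]
  show ?case
    by (rule C_class_SucI[OF bounded_bilinear.FDERIV[OF assms(1) D(1) D(3)]])
      (intro C_class_add Suc.IH D C_class_Suc_imp[OF Suc.prems(1)] C_class_Suc_imp[OF Suc.prems(2)])
qed

lemmas C_class_mult = C_class_bilinear[OF bounded_bilinear_mult]

lemma C_class_diff:
  assumes "C_class k f" and "C_class k g"
  shows "C_class k (\<lambda>x. f x - g x)"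
  using C_class_add[OF assms(1) C_class_linear[OF bounded_linear_minus[OF bounded_linear_ident] assms(2)]]
  by simp

text \<open>
  The derivative of \<open>1 / f\<close> is again a product of derivatives of \<open>f\<close> and copies of \<open>1 / f\<close>, to which
  the induction hypothesis applies.
\<close>

lemma C_class_inverse:
  fixes f :: "'a::euclidean_space \<Rightarrow> real"
  assumes "C_class k f" and "\<And>x. f x \<noteq> 0"
  shows "C_class k (\<lambda>x. inverse (f x))"
  using assms(1)
proof (induction k)
  case 0
  then show ?case by (simp add: continuous_on_inverse assms(2))
next
  case (Suc k)
  note D = C_class_SucD[OF Suc.prems] and IH = Suc.IH[OF C_class_Suc_imp[OF Suc.prems]]
  have "((\<lambda>x. inverse (f x)) has_derivative
      (\<lambda>h. (- 1) * (inverse (f x) * frechet_derivative f (at x) h * inverse (f x)))) (at x)" for x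
    using Deriv.has_derivative_inverse[OF assms(2) D(1)] by simp
  then show ?case
    by (rule C_class_SucI) (intro C_class_mult C_class_const IH D(2))
qed

lemma C_class_sum:
  assumes "\<And>i. i \<in> I \<Longrightarrow> C_class k (f i)"
  shows "C_class k (\<lambda>x. \<Sum>i\<in>I. f i x)"
  using assms by (induction I rule: infinite_finite_induct) (simp_all add: C_class_const C_class_add)

lemma C_class_prod:
  fixes f :: "'i \<Rightarrow> 'a::euclidean_space \<Rightarrow> real"
  assumes "\<And>i. i \<in> I \<Longrightarrow> C_class k (f i)"
  shows "C_class k (\<lambda>x. \<Prod>i\<in>I. f i x)"
  using assms by (induction I rule: infinite_finite_induct) (simp_all add: C_class_const C_class_mult)

text \<open>
  The determinant is a polynomial in the matrix entries.
\<close>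

lemma C_class_det:
  fixes A :: "'a::euclidean_space \<Rightarrow> real ^ 'n ^ 'n"
  assumes "\<And>i j. C_class k (\<lambda>x. A x $ i $ j)"
  shows "C_class k (\<lambda>x. det (A x))"
  unfolding det_def by (intro C_class_sum C_class_mult C_class_const C_class_prod assms)

lemma C_class_vec_nth: "C_class k f \<Longrightarrow> C_class k (\<lambda>x. f x $ i)"
  by (rule C_class_linear[OF bounded_linear_vec_nth])

lemma C_class_vecI:
  fixes f :: "'a::euclidean_space \<Rightarrow> real ^ 'n"
  assumes "\<And>i. C_class k (\<lambda>x. f x $ i)"
  shows "C_class k f"
proof -
  have "C_class k (\<lambda>x. \<Sum>i\<in>UNIV. f x $ i *\<^sub>R (axis i 1 :: real ^ 'n))"
    by (intro C_class_sum C_class_linear[OF bounded_linear_scaleR_left] assms)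
  moreover have "(\<lambda>x. \<Sum>i\<in>UNIV. f x $ i *\<^sub>R axis i 1) = f"
    using basis_expansion[of "f _"] by (simp add: scalar_mult_eq_scaleR)
  ultimately show ?thesis by (simp only:)
qed

lemma C_class_Pair:
  assumes "C_class k f" and "C_class k g"
  shows "C_class k (\<lambda>x. (f x, g x))"
proof -
  have "C_class k (\<lambda>x. (f x, 0) + (0, g x))"
    by (intro C_class_add C_class_linear[OF bounded_linear_Pair[OF bounded_linear_ident bounded_linear_zero]]
        C_class_linear[OF bounded_linear_Pair[OF bounded_linear_zero bounded_linear_ident]] assms)
  then show ?thesis by simp
qed

lemma C_class_linear_self:
  assumes "bounded_linear T" shows "C_class k T"
proof (cases k)
  case 0
  then show ?thesis
    using linear_continuous_on[OF assms] by simp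
next
  case (Suc m)
  then show ?thesis
    using C_class_SucI[of T "\<lambda>x. T"] C_class_const bounded_linear_imp_has_derivative[OF assms] by blast
qed

section \<open>Local solvability of ordinary differential equations\<close>

text \<open>
  Each of the finitely many directional derivatives along the basis is bounded on the compact set, hence
  so is the operator norm of the derivative, and the mean value inequality on the convex set applies.
\<close>

lemma C1_imp_lipschitz:
  fixes F :: "'a::euclidean_space \<Rightarrow> 'b::euclidean_space"
  assumes "C_class 1 F" and "compact S" and "convex S"
  obtains K where "K \<ge> 0" and "\<And>x y. x \<in> S \<Longrightarrow> y \<in> S \<Longrightarrow> dist (F x) (F y) \<le> K * dist x y"
proof -
  let ?D = "\<lambda>x. frechet_derivative F (at x)"
  have D: "(F has_derivative ?D x) (at x)" and cont: "continuous_on UNIV (\<lambda>x. ?D x h)" for x h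
    using assms(1) C_class_SucD[of 0 F] by auto
  have "\<exists>M. \<forall>x\<in>S. norm (?D x b) \<le> M" for b
    using compact_imp_bounded[OF compact_continuous_image[OF continuous_on_subset[OF cont[of b]] assms(2)]]
    by (auto simp: bounded_iff)
  then obtain M where M: "\<And>x b. x \<in> S \<Longrightarrow> norm (?D x b) \<le> M b" by metis
  let ?K = "\<Sum>b\<in>Basis. \<bar>M b\<bar>"
  have "onorm (?D x) \<le> ?K" if "x \<in> S" for x
  proof (rule onorm_bound)
    fix h
    interpret linear "?D x" using has_derivative_linear[OF D] .
    have "norm (?D x h) = norm (\<Sum>b\<in>Basis. (h \<bullet> b) *\<^sub>R ?D x b)"
      by (subst euclidean_representation[symmetric]) (simp add: sum scaleR)
    also have "\<dots> \<le> (\<Sum>b\<in>Basis. \<bar>M b\<bar> * norm h)"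
    proof (rule sum_norm_le)
      fix b :: 'a assume "b \<in> Basis"
      then have "norm ((h \<bullet> b) *\<^sub>R ?D x b) \<le> norm h * \<bar>M b\<bar>"
        using M[OF that, of b] Basis_le_norm[of b h] by (auto intro!: mult_mono)
      then show "norm ((h \<bullet> b) *\<^sub>R ?D x b) \<le> \<bar>M b\<bar> * norm h" by (simp add: mult.commute)
    qed
    finally show "norm (?D x h) \<le> ?K * norm h" by (simp add: sum_distrib_right)
  qed (simp add: sum_nonneg)
  then have "dist (F x) (F y) \<le> ?K * dist x y" if "x \<in> S" "y \<in> S" for x y
    using differentiable_bound[OF assms(3) has_derivative_at_withinI[OF D], of ?K x y] that
    by (auto simp: dist_norm)
  then show thesis using that[of ?K] by (simp add: sum_nonneg)
qed

text \<open>
  Banach's fixed point theorem for the Picard operator. To work in the complete space of bounded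
  continuous functions on the whole line, the integral is evaluated at the time clamped to
  \<open>[-a, a]\<close>; the fixed point solves the equation inside that interval.
\<close>

lemma lipschitz_ode_local_solution:
  fixes G :: "'a::euclidean_space \<Rightarrow> 'a"
  assumes lip: "\<And>x y. dist (G x) (G y) \<le> K * dist x y" and "K \<ge> 0"
  obtains a \<phi> where "a > 0" and "\<phi> 0 = x0"
    and "\<And>s. s \<in> {-a<..<a} \<Longrightarrow> (\<phi> has_vector_derivative G (\<phi> s)) (at s)"
proof -
  \<comment> \<open>The two integrals over subintervals of \<open>[-a, a]\<close> below contribute at most
      \<open>3 a K\<close> to the Lipschitz constant of the Picard operator.\<close>
  define a where "a = 1 / (6 * (K + 1))"
  have a: "a > 0" and aK: "3 * a * K \<le> 1/2"
    using \<open>K \<ge> 0\<close> by (auto simp: a_def field_simps)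
  have G_cont: "continuous_on S G" for S
    using lip \<open>K \<ge> 0\<close> by (intro lipschitz_on_continuous_on[of K]) (simp add: lipschitz_on_def)
  \<comment> \<open>The antiderivative of \<open>g\<close> with value \<open>x0\<close> at \<open>0\<close>, written with base point \<open>-a\<close> because the integral
      from \<open>0\<close> would be \<open>0\<close> for negative \<open>s\<close>.\<close>
  define J where "J g s = x0 + (integral {-a..s} g - integral {-a..0} g)" for g and s :: real
  have J_deriv: "(J g has_vector_derivative g s) (at s within {-a..a})"
    if "continuous_on {-a..a} g" "s \<in> {-a..a}" for g s
    unfolding J_def using integral_has_vector_derivative[OF that]
    by (auto intro!: derivative_eq_intros)
  have J_cont: "continuous_on {-a..a} (J g)" if "continuous_on {-a..a} g" for g
    using J_deriv[OF that] unfolding continuous_on_eq_continuous_within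
    by (blast intro: has_vector_derivative_continuous)
  have G\<phi>: "continuous_on {-a..a} (\<lambda>s. G (apply_bcontfun \<phi> s))" for \<phi> :: "real \<Rightarrow>\<^sub>C 'a"
    by (rule continuous_on_compose2[OF G_cont[of UNIV]])
      (auto intro: continuous_intros)
  have "\<exists>\<psi> :: real \<Rightarrow>\<^sub>C 'a. \<forall>s.
      apply_bcontfun \<psi> s = J (\<lambda>s. G (apply_bcontfun \<phi> s)) (clamp (-a) a s)" for \<phi>
    using continuous_on_cbox_bcontfunE[of "-a" a "J (\<lambda>s. G (apply_bcontfun \<phi> s))"] J_cont[OF G\<phi>]
    by (metis box_real(2))
  then obtain T :: "(real \<Rightarrow>\<^sub>C 'a) \<Rightarrow> (real \<Rightarrow>\<^sub>C 'a)" where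
    T: "\<And>\<phi> s. apply_bcontfun (T \<phi>) s = J (\<lambda>s. G (apply_bcontfun \<phi> s)) (clamp (-a) a s)"
    by metis
  have "dist (T \<phi>) (T \<psi>) \<le> 1/2 * dist \<phi> \<psi>" for \<phi> \<psi>
  proof (rule dist_bound)
    fix s :: real
    define u where "u = clamp (-a) a s"
    have u: "-a \<le> u" "u \<le> a"
      using clamp_in_interval[of "-a" a s] a by (auto simp: u_def)
    let ?g = "\<lambda>s. G (apply_bcontfun \<phi> s)" and ?h = "\<lambda>s. G (apply_bcontfun \<psi> s)"
    have int: "?g integrable_on {-a..r}" "?h integrable_on {-a..r}" if "r \<le> a" for r
    proof -
      have "{-a..r} \<subseteq> {-a..a}" using that by auto
      then show "?g integrable_on {-a..r}" "?h integrable_on {-a..r}"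
        using continuous_on_subset[OF G\<phi>] integrable_continuous_real by blast+
    qed
    have est: "norm (integral {-a..r} (\<lambda>s. ?g s - ?h s)) \<le> K * dist \<phi> \<psi> * (r + a)"
      if "-a \<le> r" "r \<le> a" for r
    proof -
      have "norm (?g t - ?h t) \<le> K * dist \<phi> \<psi>" for t
        using \<open>K \<ge> 0\<close>
        unfolding dist_norm[symmetric] by (intro order_trans[OF lip mult_left_mono[OF dist_bounded]])
      then show ?thesis
        using integral_bound[of "-a" r "\<lambda>s. ?g s - ?h s" "K * dist \<phi> \<psi>"] that
          continuous_on_subset[OF continuous_on_diff[OF G\<phi> G\<phi>], of "{-a..r}"] by auto
    qed
    have "apply_bcontfun (T \<phi>) s - apply_bcontfun (T \<psi>) s
        = integral {-a..u} (\<lambda>s. ?g s - ?h s) - integral {-a..0} (\<lambda>s. ?g s - ?h s)"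
      using a u by (simp add: T J_def u_def[symmetric] integral_diff int)
    also have "norm \<dots> \<le> K * dist \<phi> \<psi> * (u + a) + K * dist \<phi> \<psi> * (0 + a)"
      using est[of u] est[of 0] u a by (intro order_trans[OF norm_triangle_ineq4] add_mono) auto
    also have "\<dots> \<le> K * dist \<phi> \<psi> * (3 * a)"
    proof -
      have "K * dist \<phi> \<psi> * ((u + a) + a) \<le> K * dist \<phi> \<psi> * (3 * a)"
        using u \<open>K \<ge> 0\<close> by (intro mult_left_mono) auto
      then show ?thesis by (simp add: algebra_simps)
    qed
    also have "\<dots> \<le> 1/2 * dist \<phi> \<psi>"
      using mult_right_mono[OF aK, of "dist \<phi> \<psi>"] by (simp add: mult_ac)
    finally show "dist (apply_bcontfun (T \<phi>) s) (apply_bcontfun (T \<psi>) s) \<le> 1/2 * dist \<phi> \<psi>"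
      by (simp add: dist_norm)
  qed
  then obtain \<phi> where "T \<phi> = \<phi>"
    using banach_fix_type[of "1/2" T] by auto
  then have fixpoint: "apply_bcontfun \<phi> s = J (\<lambda>s. G (apply_bcontfun \<phi> s)) s" if "s \<in> {-a..a}" for s
    using T[of \<phi> s] that by (metis box_real(2) clamp_cancel_cbox)
  show thesis
  proof (rule that[of a "apply_bcontfun \<phi>"])
    show "apply_bcontfun \<phi> 0 = x0"
      using fixpoint[of 0] a by (simp only: J_def) simp
    fix s assume s: "s \<in> {-a<..<a}"
    then have "(J (\<lambda>s. G (apply_bcontfun \<phi> s)) has_vector_derivative G (apply_bcontfun \<phi> s)) (at s)"
      using J_deriv[OF G\<phi>, of s \<phi>] at_within_Icc_at[of "-a" s a] by auto
    then show "(apply_bcontfun \<phi> has_vector_derivative G (apply_bcontfun \<phi> s)) (at s)"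
      by (rule has_vector_derivative_transform_within_open[where S = "{-a<..<a}"])
        (use s in \<open>auto simp: fixpoint[symmetric]\<close>)
  qed (fact a)
qed

text \<open>
  Outside the unit ball around the initial value the vector field is replaced by its value at the nearest
  point of the ball. The modified field is globally Lipschitz because this projection does not increase
  distances, and it agrees with \<open>F\<close> as long as the solution has not left the ball.
\<close>

lemma C1_ode_local_solution:
  fixes F :: "'a::euclidean_space \<Rightarrow> 'a"
  assumes "C_class 1 F"
  shows "\<exists>a>0. \<exists>\<phi>. \<phi> 0 = x0 \<and> (\<forall>s\<in>{-a<..<a}. (\<phi> has_vector_derivative F (\<phi> s)) (at s))"
proof -
  let ?B = "cball x0 1"
  let ?P = "closest_point ?B"
  obtain K where "K \<ge> 0" and K: "\<And>x y. x \<in> ?B \<Longrightarrow> y \<in> ?B \<Longrightarrow> dist (F x) (F y) \<le> K * dist x y"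
    using C1_imp_lipschitz[OF assms compact_cball convex_cball] by blast
  have "dist (F (?P x)) (F (?P y)) \<le> K * dist x y" for x y
  proof -
    have "dist (F (?P x)) (F (?P y)) \<le> K * dist (?P x) (?P y)"
      by (intro K closest_point_in_set) auto
    also have "\<dots> \<le> K * dist x y"
      using \<open>K \<ge> 0\<close> by (intro mult_left_mono closest_point_lipschitz) auto
    finally show ?thesis .
  qed
  then obtain a \<phi> where a: "a > 0" and "\<phi> 0 = x0"
    and \<phi>: "\<And>s. s \<in> {-a<..<a} \<Longrightarrow> (\<phi> has_vector_derivative F (?P (\<phi> s))) (at s)"
    using lipschitz_ode_local_solution[of "\<lambda>x. F (?P x)" K x0] \<open>K \<ge> 0\<close> by metis
  have "isCont \<phi> 0"
    using \<phi>[of 0] a by (auto intro: has_vector_derivative_continuous)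
  then obtain d where "d > 0" and d: "\<And>s. dist s 0 < d \<Longrightarrow> dist (\<phi> s) (\<phi> 0) < 1"
    unfolding continuous_at by (metis zero_less_one continuous_at continuous_at_eps_delta)
  show ?thesis
  proof (intro exI[of _ "min a d"] exI[of _ \<phi>] conjI ballI)
    fix s assume s: "s \<in> {-min a d<..<min a d}"
    then have "\<bar>s\<bar> < d" by auto
    then have "\<phi> s \<in> ?B"
      using d[of s] \<open>\<phi> 0 = x0\<close> by (simp add: dist_commute)
    then show "(\<phi> has_vector_derivative F (\<phi> s)) (at s)"
      using \<phi>[of s] s by (auto simp: closest_point_self)
  qed (use a \<open>d > 0\<close> \<open>\<phi> 0 = x0\<close> in auto)
qed

section \<open>Partial derivatives and the derivative along the flow\<close>

text \<open>
  The partial derivatives are restrictions of the joint derivative to the coordinate directions, so the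
  derivative along the flow is the directional derivative along \<open>(1, v, Lam L t q v)\<close>. In this form
  it inherits the sum and product rules from the joint derivative.
\<close>

lemma has_derivative_tqv:
  fixes F :: "real \<Rightarrow> real ^ 'n \<Rightarrow> real ^ 'n \<Rightarrow> 'b::euclidean_space"
  assumes "((\<lambda>(t, q, v). F t q v) has_derivative D) (at (t, q, v))"
  shows pd_t_eq: "pd_t F t q v = D (1, 0, 0)"
    and pd_q_eq: "pd_q F t q v h = D (0, h, 0)"
    and pd_v_eq: "pd_v F t q v h = D (0, 0, h)"
    and flow_deriv_eq: "flow_deriv L F t q v = D (1, v, Lam L t q v)"
proof -
  interpret linear D using has_derivative_linear[OF assms] .
  have "((\<lambda>s. (s, q, v)) has_derivative (\<lambda>h. (h, 0, 0))) (at t)"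
    by (intro has_derivative_Pair has_derivative_ident has_derivative_const)
  from has_derivative_compose[OF this assms]
  have "((\<lambda>s. F s q v) has_derivative (\<lambda>h. D (h, 0, 0))) (at t)"
    by simp
  then have "((\<lambda>s. F s q v) has_vector_derivative D (1, 0, 0)) (at t)"
    by (simp add: has_vector_derivative_def flip: scaleR)
  then show t: "pd_t F t q v = D (1, 0, 0)"
    unfolding pd_t_def by (rule vector_derivative_at)
  have "((\<lambda>y. (t, y, v)) has_derivative (\<lambda>h. (0, h, 0))) (at q)"
    by (intro has_derivative_Pair has_derivative_ident has_derivative_const)
  from has_derivative_compose[OF this assms]
  have "((\<lambda>y. F t y v) has_derivative (\<lambda>h. D (0, h, 0))) (at q)"
    by simp
  then show q: "pd_q F t q v h = D (0, h, 0)" for h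
    unfolding pd_q_def by (metis frechet_derivative_at)
  have "((\<lambda>w. (t, q, w)) has_derivative (\<lambda>h. (0, 0, h))) (at v)"
    by (intro has_derivative_Pair has_derivative_ident has_derivative_const)
  from has_derivative_compose[OF this assms]
  have "((\<lambda>w. F t q w) has_derivative (\<lambda>h. D (0, 0, h))) (at v)"
    by simp
  then show v: "pd_v F t q v h = D (0, 0, h)" for h
    unfolding pd_v_def by (metis frechet_derivative_at)
  show "flow_deriv L F t q v = D (1, v, Lam L t q v)"
    unfolding flow_deriv_def t q v by (simp flip: add)
qed

lemma C_class_tqv_has_derivative:
  assumes "C_class_tqv k F" and "k \<ge> 1"
  shows "((\<lambda>(t, q, v). F t q v) has_derivative
    frechet_derivative (\<lambda>(t, q, v). F t q v) (at x)) (at x)"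
  using C_class_mono[OF assms(1)[unfolded C_class_tqv_def] assms(2)] C_class_SucD(1)[of 0]
  by (simp only: One_nat_def)

lemma C_class_tqv_pd:
  assumes "C_class_tqv (Suc k) F"
  shows "C_class_tqv k (pd_t F)"
    and "C_class_tqv k (\<lambda>t q v. pd_q F t q v h)"
    and "C_class_tqv k (\<lambda>t q v. pd_v F t q v h)"
  using C_class_SucD(2)[OF assms[unfolded C_class_tqv_def]]
    has_derivative_tqv(1-3)[OF C_class_tqv_has_derivative[OF assms]]
  by (simp_all add: C_class_tqv_def case_prod_beta')

lemma C_class_tqv_grad:
  assumes "C_class_tqv (Suc k) F"
  shows "C_class_tqv k (grad_q F)" and "C_class_tqv k (grad_v F)"
  using C_class_tqv_pd[OF assms]
  by (auto simp: C_class_tqv_def grad_q_def grad_v_def case_prod_beta' intro!: C_class_vecI)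

lemma linear_functional_inner:
  fixes g :: "real ^ 'n \<Rightarrow> real"
  assumes "linear g"
  shows "g h = (\<chi> i. g (axis i 1)) \<bullet> h"
proof -
  interpret linear g by fact
  have "g h = g (\<Sum>i\<in>UNIV. h $ i *\<^sub>R axis i 1)"
    using basis_expansion[of h] by (simp add: scalar_mult_eq_scaleR)
  also have "\<dots> = (\<chi> i. g (axis i 1)) \<bullet> h"
    by (simp add: sum scaleR inner_vec_def mult.commute)
  finally show ?thesis .
qed

lemma inner_grad:
  fixes F :: "real \<Rightarrow> real ^ 'n \<Rightarrow> real ^ 'n \<Rightarrow> real"
  assumes "((\<lambda>(t, q, v). F t q v) has_derivative D) (at (t, q, v))"
  shows "D (s, h, k) = s * pd_t F t q v + grad_q F t q v \<bullet> h + grad_v F t q v \<bullet> k"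
proof -
  interpret linear D using has_derivative_linear[OF assms] .
  have lin: "linear (\<lambda>h. D (0, h, 0))" "linear (\<lambda>h. D (0, 0, h))"
    by (intro linearI; simp flip: add scaleR real_scaleR_def)+
  have q: "D (0, h, 0) = grad_q F t q v \<bullet> h" and v: "D (0, 0, k) = grad_v F t q v \<bullet> k"
    using linear_functional_inner[OF lin(1), of h] linear_functional_inner[OF lin(2), of k]
    by (simp_all add: grad_q_def grad_v_def pd_q_eq[OF assms] pd_v_eq[OF assms])
  have "D (s, h, k) = D (s *\<^sub>R (1, 0, 0) + (0, h, 0) + (0, 0, k))"
    by simp
  also have "\<dots> = s *\<^sub>R D (1, 0, 0) + D (0, h, 0) + D (0, 0, k)"
    by (simp only: add scaleR)
  finally show ?thesis
    by (simp add: q v pd_t_eq[OF assms])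
qed

text \<open>
  The chain rule that links the pointwise operator \<open>flow_deriv L\<close> to curves. For the momentum
  \<open>grad_v L\<close> it shows that integral curves of the normal form solve the Lagrange equation; for \<open>N\<close>
  it turns constancy into a differential equation.
\<close>

lemma has_vector_derivative_along:
  fixes F :: "real \<Rightarrow> real ^ 'n \<Rightarrow> real ^ 'n \<Rightarrow> 'b::euclidean_space"
  assumes F: "C_class_tqv k F" "k \<ge> 1"
    and x: "(x has_vector_derivative y t) (at t)"
    and y: "(y has_vector_derivative Lam L t (x t) (y t)) (at t)"
  shows "((\<lambda>s. F s (x s) (y s)) has_vector_derivative flow_deriv L F t (x t) (y t)) (at t)"
proof -
  note D = C_class_tqv_has_derivative[OF F, of "(t, x t, y t)"]
  have "((\<lambda>s. (s, x s, y s)) has_derivative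
      (\<lambda>h. h *\<^sub>R (1, y t, Lam L t (x t) (y t)))) (at t)"
    using x y by (auto intro!: has_derivative_Pair has_derivative_ident simp: has_vector_derivative_def)
  from has_derivative_compose[OF this D] show ?thesis
    by (simp add: has_vector_derivative_def flow_deriv_eq[OF D]
        flip: linear.scaleR[OF has_derivative_linear[OF D]])
qed

lemma matrix_pd:
  fixes F :: "real \<Rightarrow> real ^ 'n \<Rightarrow> real ^ 'n \<Rightarrow> real ^ 'm"
  assumes "C_class_tqv 1 F"
  shows "matrix (pd_q F t q v) *v h = pd_q F t q v h"
    and "matrix (pd_v F t q v) *v h = pd_v F t q v h"
proof -
  note D = C_class_tqv_has_derivative[OF assms order_refl, of "(t, q, v)"]
  interpret linear "frechet_derivative (\<lambda>(t, q, v). F t q v) (at (t, q, v))"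
    using has_derivative_linear[OF D] .
  have "linear (pd_q F t q v)" "linear (pd_v F t q v)"
    by (intro linearI; simp add: has_derivative_tqv[OF D] flip: add scaleR)+
  then show "matrix (pd_q F t q v) *v h = pd_q F t q v h"
    and "matrix (pd_v F t q v) *v h = pd_v F t q v h"
    by (simp_all add: matrix_works linear_matrix_vector_mul_eq)
qed

section \<open>The normal form of the Lagrange equation\<close>

lemma matrix_inv_mult_vec:
  fixes A :: "real ^ 'n ^ 'n"
  assumes "det A \<noteq> 0"
  shows "A *v (matrix_inv A *v b) = b"
proof -
  have "\<exists>B. A ** B = mat 1 \<and> B ** A = mat 1"
    using assms by (simp flip: invertible_det_nz invertible_def)
  then have "A ** matrix_inv A = mat 1"
    unfolding matrix_inv_def by (rule someI2_ex) simp
  then show ?thesis by (simp add: matrix_vector_mul_assoc)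
qed

text \<open>
  This is the Lagrange equation in normal form: \<open>Lam L\<close> is chosen so that the Hessian applied to it
  is the part of \<open>grad_q L\<close> that the \<open>t\<close>- and \<open>q\<close>-derivatives of the momentum \<open>grad_v L\<close>
  do not account for.
\<close>

lemma flow_deriv_grad_v:
  fixes L :: "real \<Rightarrow> real ^ 'n \<Rightarrow> real ^ 'n \<Rightarrow> real"
  assumes "C_class_tqv 3 L" and "det (hess_vv L t q v) \<noteq> 0"
  shows "flow_deriv L (grad_v L) t q v = grad_q L t q v"
proof -
  have "C_class_tqv 1 (grad_v L)"
    using C_class_tqv_grad(2)[of 2 L] assms(1) C_class_mono[of 2 _ 1]
    by (simp add: C_class_tqv_def eval_nat_numeral del: C_class.simps)
  note M = matrix_pd[OF this, of t q v]
  have "hess_vv L t q v *v Lam L t q v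
      = grad_q L t q v - pd_t (grad_v L) t q v - hess_vq L t q v *v v"
    unfolding Lam_def by (rule matrix_inv_mult_vec[OF assms(2)])
  then show ?thesis
    by (simp add: flow_deriv_def hess_vv_def hess_vq_def M algebra_simps)
qed

text \<open>
  Cramer's rule writes the components of \<open>Lam L\<close> as quotients of determinants. Their entries are
  combinations of first and second derivatives of \<open>L\<close> and of the velocity, hence of class \<open>C\<^sup>1\<close>,
  and the denominator does not vanish.
\<close>

lemma C1_Lam:
  fixes L :: "real \<Rightarrow> real ^ 'n \<Rightarrow> real ^ 'n \<Rightarrow> real"
  assumes "C_class_tqv 3 L" and det: "\<And>t q v. det (hess_vv L t q v) \<noteq> 0"
  shows "C_class_tqv 1 (Lam L)"
proof -
  let ?r = "\<lambda>t q v. grad_q L t q v - pd_t (grad_v L) t q v - hess_vq L t q v *v v"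
  have Lam: "Lam L t q v = (\<chi> k. det (\<chi> i j. if j = k then ?r t q v $ i else hess_vv L t q v $ i $ j)
      * inverse (det (hess_vv L t q v)))" for t q v
    using cramer[OF det, of t q v "Lam L t q v" "?r t q v"] matrix_inv_mult_vec[OF det, of t q v]
    by (simp add: Lam_def divide_inverse)
  have L3: "C_class_tqv (Suc (Suc 1)) L" using assms(1) by (simp add: eval_nat_numeral)
  note G = C_class_tqv_grad[OF L3]
  have grad_q: "C_class 1 (\<lambda>x. grad_q L (fst x) (fst (snd x)) (snd (snd x)))"
    using C_class_Suc_imp[OF G(1)[unfolded C_class_tqv_def]] by (simp add: case_prod_beta' del: C_class.simps)
  have pd: "C_class 1 (\<lambda>x. pd_t (grad_v L) (fst x) (fst (snd x)) (snd (snd x)))"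
     "C_class 1 (\<lambda>x. pd_q (grad_v L) (fst x) (fst (snd x)) (snd (snd x)) h)"
     "C_class 1 (\<lambda>x. pd_v (grad_v L) (fst x) (fst (snd x)) (snd (snd x)) h)" for h
    using C_class_tqv_pd[OF G(2)] by (simp_all add: C_class_tqv_def case_prod_beta' del: C_class.simps)
  have entries: "C_class 1 (\<lambda>x. hess_vv L (fst x) (fst (snd x)) (snd (snd x)) $ i $ j)"
    "C_class 1 (\<lambda>x. hess_vq L (fst x) (fst (snd x)) (snd (snd x)) $ i $ j)" for i j
    unfolding hess_vv_def hess_vq_def matrix_def
    using C_class_vec_nth[OF pd(3)] C_class_vec_nth[OF pd(2)] by (simp_all del: C_class.simps One_nat_def)
  have v: "C_class 1 (\<lambda>x :: real \<times> (real ^ 'n) \<times> (real ^ 'n). snd (snd x) $ i)" for i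
    by (intro C_class_vec_nth C_class_linear_self bounded_linear_snd_comp bounded_linear_ident bounded_linear_snd)
  have r: "C_class 1 (\<lambda>x. ?r (fst x) (fst (snd x)) (snd (snd x)) $ i)" for i
    unfolding vector_minus_component matrix_vector_mult_def vec_lambda_beta
    by (intro C_class_diff C_class_vec_nth grad_q pd C_class_sum C_class_mult entries v)
  have entry: "C_class 1 (\<lambda>x. (\<chi> i j. if j = k then ?r (fst x) (fst (snd x)) (snd (snd x)) $ i
        else hess_vv L (fst x) (fst (snd x)) (snd (snd x)) $ i $ j) $ i $ j)" for i j k
    using r[of i] entries(1)[of i j] by (cases "j = k") 
      (simp_all del: C_class.simps One_nat_def vector_minus_component)
  show ?thesis
    unfolding C_class_tqv_def case_prod_beta' Lam
    by (rule C_class_vecI)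
      (unfold vec_lambda_beta, intro C_class_mult C_class_det C_class_inverse entry entries det)
qed

section \<open>Solutions and first integrals\<close>

text \<open>
  The second-order equation is turned into an autonomous first-order system for \<open>(t, q, v)\<close>. The
  initial time of that system is \<open>0\<close>; shifting it to \<open>t0\<close> makes its first component equal to time.
\<close>

lemma lagrange_solution_through:
  fixes L :: "real \<Rightarrow> real ^ 'n \<Rightarrow> real ^ 'n \<Rightarrow> real"
  assumes "C_class_tqv 3 L" and "\<And>t q v. det (hess_vv L t q v) \<noteq> 0"
  obtains I x where "lagrange_solution L I x" and "t0 \<in> I"
    and "x t0 = q0" and "velocity x t0 = v0"
    and "(velocity x has_vector_derivative Lam L t0 q0 v0) (at t0)"
proof -
  let ?F = "\<lambda>(t, q, v). (1 :: real, v, Lam L t q v)"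
  have "C_class 1 (\<lambda>x :: real \<times> (real ^ 'n) \<times> (real ^ 'n). snd (snd x))"
    by (intro C_class_linear_self bounded_linear_snd_comp bounded_linear_snd)
  then have "C_class 1 ?F"
    using C1_Lam[OF assms] unfolding C_class_tqv_def case_prod_beta'
    by (intro C_class_Pair C_class_const)
  from C1_ode_local_solution[OF this, of "(t0, q0, v0)"]
  obtain a \<phi> where "a > 0" and \<phi>0: "\<phi> 0 = (t0, q0, v0)"
    and \<phi>: "\<And>s. s \<in> {-a<..<a} \<Longrightarrow> (\<phi> has_vector_derivative ?F (\<phi> s)) (at s)"
    by blast
  define T where "T = (\<lambda>t. fst (\<phi> (t - t0)))"
  define x where "x = (\<lambda>t. fst (snd (\<phi> (t - t0))))"
  define y where "y = (\<lambda>t. snd (snd (\<phi> (t - t0))))"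
  define I where "I = {t0 - a<..<t0 + a}"
  have \<psi>: "((\<lambda>t. \<phi> (t - t0)) has_vector_derivative (1, y t, Lam L (T t) (x t) (y t))) (at t)"
    if "t \<in> I" for t
  proof -
    have "((\<lambda>t. t - t0) has_vector_derivative 1) (at t)"
      by (auto intro!: derivative_eq_intros simp: has_vector_derivative_def)
    moreover have "t - t0 \<in> {-a<..<a}" using that by (auto simp: I_def)
    ultimately show ?thesis
      using vector_diff_chain_at[of "\<lambda>t. t - t0" 1 t \<phi>, OF _ \<phi>[of "t - t0"]]
      by (auto simp: o_def T_def x_def y_def case_prod_beta)
  qed
  have T': "(T has_vector_derivative 1) (at t)" and x': "(x has_vector_derivative y t) (at t)"
    and y': "(y has_vector_derivative Lam L (T t) (x t) (y t)) (at t)" if "t \<in> I" for t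
  proof -
    note d = \<psi>[OF that, unfolded has_vector_derivative_def]
    note d2 = has_derivative_snd[OF d]
    show "(T has_vector_derivative 1) (at t)" "(x has_vector_derivative y t) (at t)"
      "(y has_vector_derivative Lam L (T t) (x t) (y t)) (at t)"
      using has_derivative_fst[OF d] has_derivative_fst[OF d2] has_derivative_snd[OF d2]
      by (simp_all add: has_vector_derivative_def T_def x_def y_def)
  qed
  have t0: "t0 \<in> I" using \<open>a > 0\<close> by (simp add: I_def)
  have T: "T t = t" if "t \<in> I" for t
  proof -
    have "T t - t = T t0 - t0"
    proof (rule has_derivative_zero_unique_connected[where f = "\<lambda>t. T t - t" and s = I])
      show "((\<lambda>t. T t - t) has_derivative (\<lambda>h. 0)) (at s)" if "s \<in> I" for s
        using T'[OF that] by (auto intro!: derivative_eq_intros simp: has_vector_derivative_def)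
    qed (use that t0 in \<open>auto simp: I_def\<close>)
    then show ?thesis by (simp add: T_def \<phi>0)
  qed
  have vel: "velocity x t = y t" if "t \<in> I" for t
    unfolding velocity_def by (rule vector_derivative_at[OF x'[OF that]])
  have vel': "(velocity x has_vector_derivative Lam L t (x t) (y t)) (at t)" if "t \<in> I" for t
    by (rule has_vector_derivative_transform_within_open[OF y'[OF that, unfolded T[OF that]], of I])
      (use that vel in \<open>auto simp: I_def\<close>)
  have el: "((\<lambda>s. grad_v L s (x s) (velocity x s)) has_vector_derivative
      grad_q L t (x t) (velocity x t)) (at t)" if "t \<in> I" for t
  proof -
    have "C_class_tqv 2 (grad_v L)"
      using C_class_tqv_grad(2)[of 2 L] assms(1) by (simp add: eval_nat_numeral)
    from has_vector_derivative_along[OF this, where x = x and y = "velocity x" and t = t and L = L]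
    show ?thesis
      using x'[OF that] vel'[OF that] vel[OF that] flow_deriv_grad_v[OF assms] by simp
  qed
  show thesis
  proof (rule that[of I x])
    show "lagrange_solution L I x"
      unfolding lagrange_solution_def
      using differentiableI_vector[OF x'] differentiableI_vector[OF vel'] el
      by (simp add: I_def is_interval_oo)
    show "velocity x t0 = v0" "x t0 = q0"
      using vel[OF t0] by (simp_all add: x_def y_def \<phi>0)
    then show "(velocity x has_vector_derivative Lam L t0 q0 v0) (at t0)"
      using vel'[OF t0] vel[OF t0] by simp
  qed (fact t0)
qed

text \<open>
  Through every point runs a solution, along which \<open>N\<close> is constant. Hence constancy along solutions
  forces the partial differential equation at every point.
\<close>

lemma first_integral_flow_deriv:
  assumes "C_class_tqv 3 L" and "\<And>t q v. det (hess_vv L t q v) \<noteq> 0" and "first_integral L N"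
  shows "flow_deriv L N t q v = 0"
proof -
  obtain I x where sol: "lagrange_solution L I x" and "t \<in> I" and x: "x t = q" "velocity x t = v"
    and x'': "(velocity x has_vector_derivative Lam L t q v) (at t)"
    using lagrange_solution_through[OF assms(1,2)] by blast
  have "open I" and "x differentiable at t"
    using sol \<open>t \<in> I\<close> by (auto simp: lagrange_solution_def)
  then have x': "(x has_vector_derivative v) (at t)"
    using x(2) by (simp add: velocity_def vector_derivative_works)
  have N1: "C_class_tqv 1 N" and "(\<lambda>t. N t (x t) (velocity x t)) constant_on I"
    using assms(3) sol by (auto simp: first_integral_def)
  then obtain c where c: "\<And>s. s \<in> I \<Longrightarrow> N s (x s) (velocity x s) = c"
    by (auto simp: constant_on_def)
  have "((\<lambda>s. N s (x s) (velocity x s)) has_vector_derivative flow_deriv L N t q v) (at t)"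
    using has_vector_derivative_along[OF N1 order_refl, of x "velocity x" t L] x' x'' x by simp
  moreover have "((\<lambda>s. N s (x s) (velocity x s)) has_vector_derivative 0) (at t)"
    by (rule has_vector_derivative_transform_within_open[OF has_vector_derivative_const \<open>open I\<close> \<open>t \<in> I\<close>])
      (simp add: c)
  ultimately show ?thesis
    by (rule vector_derivative_unique_at)
qed

section \<open>The on-flow Killing-type equation\<close>

text \<open>
  The Noether identity: up to the term \<open>flow_deriv L N\<close>, the right-hand side is the left-hand side
  of the Killing-type equation. It is the Leibniz rule together with
  \<open>flow_deriv L (grad_v L) = grad_q L\<close>, where the contributions
  \<open>\<tau> (grad_q L \<bullet> v)\<close> and \<open>\<tau> (grad_v L \<bullet> Lam L)\<close> of \<open>\<tau> L\<close> cancel those of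
  \<open>- \<tau> (grad_v L \<bullet> v)\<close>.
\<close>

lemma flow_deriv_noether:
  fixes L N \<tau> :: "real \<Rightarrow> real ^ 'n \<Rightarrow> real ^ 'n \<Rightarrow> real"
    and \<xi> :: "real \<Rightarrow> real ^ 'n \<Rightarrow> real ^ 'n \<Rightarrow> real ^ 'n"
  assumes L: "C_class_tqv 3 L" and det: "\<And>t q v. det (hess_vv L t q v) \<noteq> 0"
    and N: "C_class_tqv 1 N" and \<tau>: "C_class_tqv 1 \<tau>" and \<xi>: "C_class_tqv 1 \<xi>"
  shows "flow_deriv L (\<lambda>t q v. \<tau> t q v * L t q v + N t q v
        + grad_v L t q v \<bullet> (\<xi> t q v - \<tau> t q v *\<^sub>R v)) t q v
    = \<tau> t q v * pd_t L t q v + grad_q L t q v \<bullet> \<xi> t q v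
      + grad_v L t q v \<bullet> (flow_deriv L \<xi> t q v - flow_deriv L \<tau> t q v *\<^sub>R v)
      + L t q v * flow_deriv L \<tau> t q v + flow_deriv L N t q v"
proof -
  have G: "C_class_tqv 2 (grad_v L)"
    using C_class_tqv_grad(2)[of 2 L] L by (simp add: eval_nat_numeral)
  note D = C_class_tqv_has_derivative[of _ _ "(t, q, v)"]
  note DL = D[OF L] and DN = D[OF N] and D\<tau> = D[OF \<tau>] and D\<xi> = D[OF \<xi>] and DG = D[OF G]
  let ?w = "(1, v, Lam L t q v)"
  have "((\<lambda>(t, q, v). \<tau> t q v * L t q v + N t q v + grad_v L t q v \<bullet> (\<xi> t q v - \<tau> t q v *\<^sub>R v))
     has_derivative (\<lambda>h. 
       \<tau> t q v * frechet_derivative (\<lambda>(t, q, v). L t q v) (at (t, q, v)) h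
       + frechet_derivative (\<lambda>(t, q, v). \<tau> t q v) (at (t, q, v)) h * L t q v
       + frechet_derivative (\<lambda>(t, q, v). N t q v) (at (t, q, v)) h
       + (grad_v L t q v \<bullet> (frechet_derivative (\<lambda>(t, q, v). \<xi> t q v) (at (t, q, v)) h
            - (\<tau> t q v *\<^sub>R snd (snd h) + frechet_derivative (\<lambda>(t, q, v). \<tau> t q v) (at (t, q, v)) h *\<^sub>R v))
         + frechet_derivative (\<lambda>(t, q, v). grad_v L t q v) (at (t, q, v)) h \<bullet> (\<xi> t q v - \<tau> t q v *\<^sub>R v))))
     (at (t, q, v))"
    using DL DN D\<tau> D\<xi> DG unfolding case_prod_beta'
    by (auto intro!: derivative_eq_intros)
  note E = flow_deriv_eq[OF this, of L]
  have "frechet_derivative (\<lambda>(t, q, v). L t q v) (at (t, q, v)) ?w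
    = pd_t L t q v + grad_q L t q v \<bullet> v + grad_v L t q v \<bullet> Lam L t q v"
    using inner_grad[OF DL] by simp
  then show ?thesis
    unfolding E
    by (simp add: flow_deriv_eq[OF DN] flow_deriv_eq[OF D\<tau>] flow_deriv_eq[OF D\<xi>]
        flow_deriv_eq[OF DG, of L, symmetric] flow_deriv_grad_v[OF L det]
        inner_diff_right inner_add_right algebra_simps)
qed

theorem theorem1:
  fixes L N \<tau> f :: "real \<Rightarrow> real ^ 'n \<Rightarrow> real ^ 'n \<Rightarrow> real"
    and \<xi> :: "real \<Rightarrow> real ^ 'n \<Rightarrow> real ^ 'n \<Rightarrow> real ^ 'n"
  assumes "C_class_tqv 3 L"
    and "\<And>t q v. det (hess_vv L t q v) \<noteq> 0"
    and "first_integral L N"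
    and "C_class_tqv 1 \<tau>" and "C_class_tqv 1 \<xi>" and "C_class_tqv 1 f"
  shows "(killing_on_flow L \<tau> \<xi> f \<and> associated_integral L \<tau> \<xi> f = N) \<longleftrightarrow>
    (\<forall>t q v. f t q v =
       \<tau> t q v * L t q v + N t q v + grad_v L t q v \<bullet> (\<xi> t q v - \<tau> t q v *\<^sub>R v))"
    (is "_ \<longleftrightarrow> ?rhs")
proof
  assume "killing_on_flow L \<tau> \<xi> f \<and> associated_integral L \<tau> \<xi> f = N"
  then have "N t q v = associated_integral L \<tau> \<xi> f t q v" for t q v
    by simp
  then show ?rhs
    by (simp add: associated_integral_def mult.commute)
next
  assume ?rhs
  then have f: "f = (\<lambda>t q v. \<tau> t q v * L t q v + N t q v
      + grad_v L t q v \<bullet> (\<xi> t q v - \<tau> t q v *\<^sub>R v))"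
    by (intro ext) simp
  have N1: "C_class_tqv 1 N"
    using assms(3) by (simp add: first_integral_def)
  have "killing_on_flow L \<tau> \<xi> f"
    unfolding killing_on_flow_def f
    using flow_deriv_noether[OF assms(1,2) N1 assms(4,5)] first_integral_flow_deriv[OF assms(1-3)]
    by simp
  moreover have "associated_integral L \<tau> \<xi> f = N"
    by (intro ext) (simp add: associated_integral_def f mult.commute)
  ultimately show "killing_on_flow L \<tau> \<xi> f \<and> associated_integral L \<tau> \<xi> f = N" ..
qed

end
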